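(* The numbers $a_t^E(C_n)$ of time-dependent assembly trees satisfying the edge gluing rule for the cycle graphs $C_n$ satisfy $a^E_t(C_1)=a^E_t(C_2)=1$ and, for every integer $n\ge 3$, $$a^E_t(C_n)=\sum_{j=1}^{\lfloor n/2\rfloor}\left(\binom{n-j}{n-2j}+\binom{n-j-1}{n-2j}\right)a^E_t(C_{n-j}).$$
   Context: All graphs are finite and simple. Let $G=(V,E)$ be a connected graph with $|V|=N\ge 2$. A time-dependent assembly tree for $G$ is a rooted (unordered) tree each of whose nodes is labeled by a pair $(U,i)$ with $U\subseteq V$ and $i$ a nonnegative integer, such that: (1) the leaves are exactly $N$ in number, labeled $(v,0)$, one for each vertex $v\in V$ ($v$ identified with $\{v\}$); (2) each internal (non-leaf) node has at least two children; (3) the root is labeled $(V,m)$ for some $1\le m\le N-1$; (4) for each internal node $(U,i)$, $U$ is the union of the vertex sets labeling its children (equivalently, the set of leaves below it); (5) if $(U,i)$ and $(U',i')$ are adjacent nodes with $U\subseteq U'$, then $i<i'$; (6) for each $0\le i\le m$ there exists a node labeled $(U,i)$ for some $U\subseteq V$. For $N=1$, by convention the only time-dependent assembly tree is the single node $(v,0)$. Two such trees are the same if there is a label-preserving isomorphism of rooted trees between them. Such a tree satisfies the edge gluing rule if each internal node has exactly two children, with vertex sets $U_1$ and $U_2$ say, and there is an edge $v_1v_2\in E$ with $v_1\in U_1$ and $v_2\in U_2$. $a_t^E(G)$ is the number of time-dependent assembly trees for $G$ satisfying the edge gluing rule. $C_n$ is the cycle graph on vertices $1,\dots,n$ (in cyclic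 order) for $n\ge 3$; by convention $C_1$ is a single vertex and $C_2$ is a single edge on two vertices. *)

theory Defs
  imports "HOL-Library.Multiset"
begin

text \<open>Since the children of a node form a multiset, equality of these trees is the same thing as
  label-preserving isomorphism of rooted unordered trees.\<close>

datatype 'l rtree = Node (label: 'l) (children: "'l rtree multiset")

text \<open>A node is represented by the subtree hanging below it; as different nodes may carry equal
  subtrees, the nodes form a multiset.\<close>

primrec nodes :: "'l rtree \<Rightarrow> 'l rtree multiset" where
  "nodes (Node l cs) = add_mset (Node l cs) (\<Sum>\<^sub># (image_mset nodes cs))"

definition is_leaf :: "'l rtree \<Rightarrow> bool" where
  "is_leaf s \<longleftrightarrow> children s = {#}"

definition adjacent_nodes :: "'l rtree \<Rightarrow> 'l rtree \<Rightarrow> 'l rtree \<Rightarrow> bool" where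
  "adjacent_nodes t x y \<longleftrightarrow> x \<in># nodes t \<and> y \<in># nodes t \<and> (y \<in># children x \<or> x \<in># children y)"

type_synonym 'v assembly = "('v set \<times> nat) rtree"

abbreviation verts :: "'v assembly \<Rightarrow> 'v set" where
  "verts s \<equiv> fst (label s)"

abbreviation time :: "'v assembly \<Rightarrow> nat" where
  "time s \<equiv> snd (label s)"

text \<open>A graph is a pair of a vertex set and a set of two-element sets of vertices. The definitions
  below are total, but intended for finite, simple, connected, nonempty graphs.\<close>

type_synonym 'v graph = "'v set \<times> 'v set set"

definition simple_connected_graph :: "'v graph \<Rightarrow> bool" where
  "simple_connected_graph G \<longleftrightarrow> (case G of (V, E) \<Rightarrow>
     finite V \<and> V \<noteq> {} \<and> (\<forall>e\<in>E. e \<subseteq> V \<and> card e = 2) \<and>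
     (\<forall>u\<in>V. \<forall>v\<in>V. (u, v) \<in> {(x, y). {x, y} \<in> E}\<^sup>*))"

definition time_dependent_assembly_tree :: "'v graph \<Rightarrow> 'v assembly \<Rightarrow> bool" where
  "time_dependent_assembly_tree G t \<longleftrightarrow> (case G of (V, E) \<Rightarrow>
     if card V = 1 then t = Node (V, 0) {#}
     else
       (\<forall>s \<in># nodes t. verts s \<subseteq> V) \<and>
       image_mset label (filter_mset is_leaf (nodes t)) =
         image_mset (\<lambda>v. ({v}, 0)) (mset_set V) \<and>
       (\<forall>s \<in># nodes t. \<not> is_leaf s \<longrightarrow> size (children s) \<ge> 2) \<and>
       (\<exists>m. 1 \<le> m \<and> m \<le> card V - 1 \<and> label t = (V, m)) \<and>
       (\<forall>s \<in># nodes t. \<not> is_leaf s \<longrightarrow> verts s = (\<Union>c \<in> set_mset (children s). verts c)) \<and>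
       (\<forall>x y. adjacent_nodes t x y \<and> verts x \<subseteq> verts y \<longrightarrow> time x < time y) \<and>
       (\<forall>i \<le> time t. \<exists>s \<in># nodes t. time s = i))"

definition edge_gluing_rule :: "'v graph \<Rightarrow> 'v assembly \<Rightarrow> bool" where
  "edge_gluing_rule G t \<longleftrightarrow> (case G of (V, E) \<Rightarrow>
     \<forall>s \<in># nodes t. \<not> is_leaf s \<longrightarrow>
       (\<exists>c1 c2. children s = {#c1, c2#} \<and> (\<exists>v1 \<in> verts c1. \<exists>v2 \<in> verts c2. {v1, v2} \<in> E)))"

definition num_edge_glued_trees :: "'v graph \<Rightarrow> nat" where
  "num_edge_glued_trees G = card {t. time_dependent_assembly_tree G t \<and> edge_gluing_rule G t}"

text \<open>The closing edge is added only for \<open>n \<ge> 3\<close>, so that \<open>cycle_graph 1\<close> is a single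
  vertex and \<open>cycle_graph 2\<close> a single edge.\<close>

definition cycle_graph :: "nat \<Rightarrow> nat graph" where
  "cycle_graph n = ({1..n}, {{i, i + 1} | i. 1 \<le> i \<and> i < n} \<union> (if n \<ge> 3 then {{n, 1}} else {}))"

lemma simple_connected_cycle_graph:
  assumes "n \<ge> 1"
  shows "simple_connected_graph (cycle_graph n)"
proof -
  let ?E = "{{i, i + 1} | i. 1 \<le> i \<and> i < n} \<union> (if n \<ge> 3 then {{n, 1}} else {})"
  let ?R = "{(x, y). {x, y} \<in> ?E}"
  have up: "(1, k) \<in> ?R\<^sup>*" if "1 \<le> k" "k \<le> n" for k
    using that
  proof (induction k rule: nat_induct_at_least)
    case base
    show ?case by simp
  next
    case (Suc k)
    then have "(k, Suc k) \<in> ?R" by auto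
    moreover from Suc have "(1, k) \<in> ?R\<^sup>*" by simp
    ultimately show ?case by (meson rtrancl.rtrancl_into_rtrancl)
  qed
  have "sym ?R" by (auto simp: sym_def insert_commute)
  then have "sym (?R\<^sup>*)" by (rule sym_rtrancl)
  then have conn: "(u, v) \<in> ?R\<^sup>*" if "u \<in> {1..n}" "v \<in> {1..n}" for u v
    using up[of u] up[of v] that by (meson atLeastAtMost_iff rtrancl_trans symE)
  have "e \<subseteq> {1..n} \<and> card e = 2" if "e \<in> ?E" for e
    using that by (auto split: if_splits)
  with conn assms show ?thesis
    unfolding simple_connected_graph_def cycle_graph_def by simp
qed

end

theory Submission
  imports Defs "HOL-Library.Disjoint_Sets"
begin

text \<open>A time-dependent assembly tree is read from its leaves upwards. Its nodes at time \<open>1\<close> join pairs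
  of leaves, so they form a nonempty matching of the graph. Cutting everything below these nodes,
  declaring them leaves and setting all clocks back by one leaves an assembly tree of the graph in
  which the matched pairs are contracted, and no time is skipped in the new tree either. Conversely,
  the matching and the tree of the contracted graph determine the original tree. Contracting \<open>j\<close>
  disjoint edges of an \<open>n\<close>-cycle gives an \<open>(n - j)\<close>-cycle, and an \<open>n\<close>-cycle with \<open>n \<ge> 3\<close> has
  \<open>(n - j choose j) + (n - j - 1 choose j - 1)\<close> matchings with \<open>j\<close> edges: the first term counts those
  that avoid the edge from the last vertex to the first one, the second term the others. This is the
  recurrence.

  The formalization never relabels a graph. It fixes the vertices and edges and considers trees
  whose leaves are the blocks of a partition \<open>B\<close> of the vertices (\<open>gluing_trees\<close>). A contraction is
  then a coarser partition, and \<open>cut\<close> is a bijection from the trees over \<open>B\<close> to the disjoint union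
  of the trees over the proper one-step coarsenings of \<open>B\<close> (\<open>bij_betw_cut\<close>). That a partition is a
  cycle is expressed by listing its blocks in cyclic order (\<open>cycle_like\<close>); its one-step coarsenings
  are enumerated, without repetition from three blocks on, by recursively defined merged lists (\<open>coarsenings_cycle\<close>,
  \<open>inj_on_set_cyclic_mergings\<close>), which are again cyclic (\<open>cycle_like_mergings\<close>) and are counted by
  Pascal's rule (\<open>card_cyclic_mergings\<close>). Strong induction on the number of blocks gives the
  recurrence for all circular partitions (\<open>card_gluing_trees_cycle\<close>). The trees in question are
  those over the partition into singletons (\<open>assembly_trees_eq_gluing_trees\<close>).\<close>

section \<open>Partitions and their one-step coarsenings\<close>

definition linked :: "'v set set \<Rightarrow> 'v set \<Rightarrow> 'v set \<Rightarrow> bool" where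
  "linked E a b \<longleftrightarrow> (\<exists>v\<in>a. \<exists>w\<in>b. {v, w} \<in> E)"

lemma linked_commute: "linked E a b = linked E b a"
  unfolding linked_def by (metis insert_commute)

lemma linked_Un_left [simp]: "linked E (a \<union> b) c \<longleftrightarrow> linked E a c \<or> linked E b c"
  unfolding linked_def by blast

lemma linked_Un_right [simp]: "linked E c (a \<union> b) \<longleftrightarrow> linked E c a \<or> linked E c b"
  unfolding linked_def by blast

lemma linked_Union_right: "linked E c (\<Union>X) \<longleftrightarrow> (\<exists>b\<in>X. linked E c b)"
  unfolding linked_def by blast

lemma partition_block_ex:
  assumes "partition_on V B" "b \<in> B"
  shows "\<exists>x. x \<in> b"
  using assms by (metis all_not_in_conv partition_onD3)

lemma partition_block_unique:
  assumes "partition_on V B" "a \<in> B" "b \<in> B" "x \<in> a" "x \<in> b"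
  shows "a = b"
  using assms disjointD[OF partition_onD2[OF assms(1)], of a b] by blast

lemma partition_subset_eq:
  assumes "partition_on V B" "partition_on V B'" "B' \<subseteq> B"
  shows "B' = B"
proof -
  have "b \<in> B'" if "b \<in> B" for b
  proof -
    from partition_block_ex[OF assms(1) that] obtain x where x: "x \<in> b" ..
    with that have "x \<in> \<Union>B'" using assms(1,2) by (auto simp: partition_on_def)
    then obtain c where c: "c \<in> B'" "x \<in> c" by blast
    then have "c = b" using that x assms partition_block_unique[of V B c b x] by blast
    with c show ?thesis by simp
  qed
  with assms show ?thesis by blast
qed

lemma partition_Union_notin:
  assumes "partition_on V B" "a \<in> B" "b \<in> B" "a \<noteq> b"
  shows "V \<notin> B"
proof
  assume V: "V \<in> B"
  have "c = V" if "c \<in> B" for c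
  proof -
    from partition_block_ex[OF assms(1) that] obtain x where x: "x \<in> c" ..
    with that have "x \<in> V" using assms(1) by (auto simp: partition_on_def)
    with x show ?thesis using partition_block_unique[OF assms(1) that V] by blast
  qed
  with assms show False by metis
qed

lemma partition_on_Un:
  assumes "partition_on V B" "partition_on W C" "V \<inter> W = {}"
  shows "partition_on (V \<union> W) (B \<union> C)"
proof (rule partition_onI)
  show "\<Union>(B \<union> C) = V \<union> W" using assms by (simp add: partition_on_def)
  show "{} \<notin> B \<union> C" using assms by (simp add: partition_on_def)
  fix p q assume "p \<in> B \<union> C" "q \<in> B \<union> C" "p \<noteq> q"
  moreover have "disjnt p q" if "p \<in> B" "q \<in> C" for p q
    using that assms unfolding disjnt_def partition_on_def by blast
  moreover have "disjnt p q" if "p \<in> D" "q \<in> D" "p \<noteq> q" "D = B \<or> D = C" for p q D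
    using that assms by (auto simp: partition_on_def pairwise_def)
  ultimately show "disjnt p q" by (metis Un_iff disjnt_sym)
qed

text \<open>A union of two blocks can be told apart from a block, and it remembers the two blocks. This is why a
  contracted tree still determines the step that was cut off.\<close>

lemma pair_subsets:
  assumes "partition_on V B" "a \<in> B" "b \<in> B" "a \<noteq> b"
  shows "a \<union> b \<notin> B" "{e\<in>B. e \<subseteq> a \<union> b} = {a, b}"
proof -
  have *: "e = a \<or> e = b" if "e \<in> B" "e \<subseteq> a \<union> b" for e
  proof -
    from partition_block_ex[OF assms(1) that(1)] obtain x where "x \<in> e" ..
    moreover from this that(2) have "x \<in> a \<or> x \<in> b" by blast
    ultimately show ?thesis using that(1) assms by (metis partition_block_unique)
  qed
  have "a \<inter> b = {}" using partition_block_unique[OF assms(1-3)] assms(4) by blast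
  moreover have "a \<noteq> {}" "b \<noteq> {}" using assms by (auto simp: partition_on_def)
  ultimately show "a \<union> b \<notin> B" using *[of "a \<union> b"] by blast
  show "{e\<in>B. e \<subseteq> a \<union> b} = {a, b}" using * assms(2,3) by auto
qed

text \<open>A merged block consists of exactly two linked blocks, so passing from \<open>B\<close> to such a partition
  contracts a matching of the graph on the blocks. The partition \<open>B\<close> itself belongs to the
  empty matching.\<close>

definition coarsenings :: "'v set set \<Rightarrow> 'v set set \<Rightarrow> 'v set set set" where
  "coarsenings E B = {B'. partition_on (\<Union>B) B' \<and>
     (\<forall>U\<in>B'. U \<in> B \<or> (\<exists>a\<in>B. \<exists>b\<in>B. a \<noteq> b \<and> linked E a b \<and> U = a \<union> b))}"

lemma coarsenings_empty: "coarsenings E {} = {{}}"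
  by (auto simp: coarsenings_def partition_on_empty)

text \<open>The block \<open>x\<close> either survives or is merged with one of the blocks linked to it; in both cases the
  rest is an arbitrary coarsening of the untouched blocks. This is what makes coarsenings accessible
  to recursion along a list of blocks.\<close>

lemma coarsenings_insert:
  assumes part: "partition_on V (insert x R)" and "x \<notin> R"
  shows "coarsenings E (insert x R) = insert x ` coarsenings E R \<union>
    (\<Union>b\<in>{b\<in>R. linked E x b}. insert (x \<union> b) ` coarsenings E (R - {b}))"
    (is "?L = ?R1 \<union> ?R2")
proof (intro equalityI subsetI)
  have xne: "x \<noteq> {}" using part by (auto simp: partition_on_def)
  have disj: "a \<inter> b = {}" if "a \<in> insert x R" "b \<in> insert x R" "a \<noteq> b" for a b
    using that part by (meson disjointD partition_onD2)
  have ne: "a \<noteq> {}" if "a \<in> insert x R" for a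
    using that part by (meson partition_onD3)
  fix B' assume B': "B' \<in> ?L"
  then have part': "partition_on (\<Union>(insert x R)) B'"
    and bl: "\<And>U. U \<in> B' \<Longrightarrow> U \<in> insert x R \<or> (\<exists>a\<in>insert x R. \<exists>b\<in>insert x R. a \<noteq> b \<and> linked E a b \<and> U = a \<union> b)"
    by (auto simp: coarsenings_def)
  obtain v where v: "v \<in> x" using xne by auto
  then obtain U where U: "U \<in> B'" "v \<in> U" using part' by (auto simp: partition_on_def)
  \<comment> \<open>A block of \<open>B'\<close> can be removed together with the blocks \<open>C\<close> it consists of.\<close>
  have split: "B' - {\<Union>C} \<in> coarsenings E (insert x R - C)" if C: "C \<subseteq> insert x R" "\<Union>C \<in> B'" for C
  proof -
    have dj: "W \<inter> \<Union>C = {}" if "W \<in> B'" "W \<noteq> \<Union>C" for W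
      using that C part' by (meson disjointD partition_onD2)
    have "a \<inter> \<Union>C = {}" if "a \<in> insert x R - C" for a
    proof -
      have "a \<inter> c = {}" if "c \<in> C" for c using disj[of a c] \<open>a \<in> insert x R - C\<close> that C(1) by blast
      then show ?thesis by blast
    qed
    then have "\<Union>(insert x R - C) = \<Union>(insert x R) - \<Union>C" using C by blast
    moreover have "\<Union>(B' - {\<Union>C}) = \<Union>B' - \<Union>C" using dj by blast
    ultimately have "partition_on (\<Union>(insert x R - C)) (B' - {\<Union>C})"
      using part' by (auto simp: partition_on_def intro: pairwise_subset)
    moreover have notC: "a \<notin> C" if "W \<in> B'" "W \<noteq> \<Union>C" "a \<subseteq> W" "a \<in> insert x R" for a W
      using dj[OF that(1,2)] that ne[OF that(4)] by blast
    have "W \<in> insert x R - C \<or> (\<exists>a\<in>insert x R - C. \<exists>b\<in>insert x R - C. a \<noteq> b \<and> linked E a b \<and> W = a \<union> b)"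
      if W: "W \<in> B' - {\<Union>C}" for W
      using bl[of W] notC[of W] W by (metis DiffE DiffI Un_upper1 Un_upper2 insertI1 subset_refl)
    ultimately show ?thesis by (simp add: coarsenings_def)
  qed
  from bl[OF U(1)] show "B' \<in> ?R1 \<union> ?R2"
  proof
    assume "U \<in> insert x R"
    with disj[of U x] U v have "U = x" by blast
    with split[of "{x}"] U assms(2) have "B' - {x} \<in> coarsenings E R" "B' = insert x (B' - {x})" by auto
    then show ?thesis by blast
  next
    assume "\<exists>a\<in>insert x R. \<exists>b\<in>insert x R. a \<noteq> b \<and> linked E a b \<and> U = a \<union> b"
    then obtain a b where ab: "a \<in> insert x R" "b \<in> insert x R" "a \<noteq> b" "linked E a b" "U = a \<union> b" by blast
    have "a = x \<or> b = x" using disj[of a x] disj[of b x] ab U v by blast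
    then obtain c where c: "c \<in> R" "linked E x c" "U = x \<union> c"
      using ab by (metis insertE linked_commute sup_commute)
    have "insert x R - {x, c} = R - {c}" using assms(2) by auto
    with split[of "{x, c}"] c U have "B' - {x \<union> c} \<in> coarsenings E (R - {c})" "B' = insert (x \<union> c) (B' - {x \<union> c})"
      by auto
    with c show ?thesis by blast
  qed
next
  fix B' assume B': "B' \<in> ?R1 \<union> ?R2"
  have disj: "a \<inter> b = {}" if "a \<in> insert x R" "b \<in> insert x R" "a \<noteq> b" for a b
    using that part by (meson disjointD partition_onD2)
  have xne: "x \<noteq> {}" using part by (auto simp: partition_on_def)
  from B' show "B' \<in> ?L"
  proof
    assume "B' \<in> ?R1"
    then obtain C where C: "C \<in> coarsenings E R" "B' = insert x C" by auto
    have "partition_on (x \<union> \<Union>R) ({x} \<union> C)"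
      using C disj[of x] assms(2) xne by (intro partition_on_Un partition_on_space) (auto simp: coarsenings_def)
    moreover have "\<forall>U\<in>B'. U \<in> insert x R \<or> (\<exists>a\<in>insert x R. \<exists>b\<in>insert x R. a \<noteq> b \<and> linked E a b \<and> U = a \<union> b)"
      using C unfolding coarsenings_def by blast
    ultimately show ?thesis using C by (simp add: coarsenings_def)
  next
    assume "B' \<in> ?R2"
    then obtain b C where b: "b \<in> R" "linked E x b" and C: "C \<in> coarsenings E (R - {b})" "B' = insert (x \<union> b) C" by auto
    have "partition_on ((x \<union> b) \<union> \<Union>(R - {b})) ({x \<union> b} \<union> C)"
    proof (intro partition_on_Un partition_on_space)
      show "(x \<union> b) \<inter> \<Union> (R - {b}) = {}"
      proof -
        have "x \<inter> e = {}" "b \<inter> e = {}" if "e \<in> R - {b}" for e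
          using disj[of x e] disj[of b e] assms(2) b(1) that by auto
        then show ?thesis by blast
      qed
    qed (use C xne in \<open>auto simp: coarsenings_def\<close>)
    moreover have "(x \<union> b) \<union> \<Union>(R - {b}) = \<Union>(insert x R)" using b by blast
    ultimately have "partition_on (\<Union>(insert x R)) B'" using C by simp
    moreover have "\<forall>U\<in>B'. U \<in> insert x R \<or> (\<exists>a\<in>insert x R. \<exists>b\<in>insert x R. a \<noteq> b \<and> linked E a b \<and> U = a \<union> b)"
    proof
      fix U assume "U \<in> B'"
      then consider "U = x \<union> b" | "U \<in> C" using C by auto
      then show "U \<in> insert x R \<or> (\<exists>a\<in>insert x R. \<exists>b\<in>insert x R. a \<noteq> b \<and> linked E a b \<and> U = a \<union> b)"
      proof cases
        case 1
        with b assms(2) show ?thesis by blast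
      next
        case 2
        with C show ?thesis unfolding coarsenings_def by blast
      qed
    qed
    ultimately show ?thesis by (simp add: coarsenings_def)
  qed
qed

section \<open>Binary trees over the blocks of a partition\<close>

text \<open>The inductive form of the conditions on an assembly tree with the edge gluing rule, except for the
  root label and for the condition that no time is skipped, which are not inherited by subtrees.
  Disjointness of the two children replaces the condition that every leaf occurs exactly once.\<close>

inductive glued :: "'v set set \<Rightarrow> 'v set set \<Rightarrow> 'v assembly \<Rightarrow> bool" for E B where
  leaf: "b \<in> B \<Longrightarrow> glued E B (Node (b, 0) {#})"
| join: "glued E B c \<Longrightarrow> glued E B d \<Longrightarrow> verts c \<inter> verts d = {} \<Longrightarrow>
    linked E (verts c) (verts d) \<Longrightarrow> time c < i \<Longrightarrow> time d < i \<Longrightarrow>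
    glued E B (Node (verts c \<union> verts d, i) {#c, d#})"

definition times :: "'v assembly \<Rightarrow> nat set" where
  "times t = (\<lambda>s. time s) ` set_mset (nodes t)"

definition leaf_sets :: "'v assembly \<Rightarrow> 'v set set" where
  "leaf_sets t = (\<lambda>s. verts s) ` {s \<in> set_mset (nodes t). is_leaf s}"

lemma times_Node [simp]: "times (Node l cs) = insert (snd l) (\<Union>c\<in>set_mset cs. times c)"
  unfolding times_def by auto

lemma leaf_sets_Node [simp]:
  "leaf_sets (Node l cs) = (if cs = {#} then {fst l} else (\<Union>c\<in>set_mset cs. leaf_sets c))"
  unfolding leaf_sets_def by (auto simp: is_leaf_def)

lemma glued_mono: "glued E B t \<Longrightarrow> B \<subseteq> B' \<Longrightarrow> glued E B' t"
  by (induction rule: glued.induct) (auto intro: glued.intros)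

lemma time_in_times: "time t \<in> times t"
  by (cases t) simp

lemma glued_times: "glued E B t \<Longrightarrow> finite (times t) \<and> 0 \<in> times t"
  by (induction rule: glued.induct) auto

lemma glued_times_le: "glued E B t \<Longrightarrow> i \<in> times t \<Longrightarrow> i \<le> time t"
proof (induction arbitrary: i rule: glued.induct)
  case (leaf b)
  then show ?case by simp
next
  case (join c d k)
  then have "i = k \<or> i \<in> times c \<or> i \<in> times d" by auto
  with join show ?case by fastforce
qed

lemma glued_Union_leaf_sets: "glued E B t \<Longrightarrow> \<Union>(leaf_sets t) = verts t"
  by (induction rule: glued.induct) auto

lemma glued_leaf_sets_subset: "glued E B t \<Longrightarrow> leaf_sets t \<subseteq> B"
  by (induction rule: glued.induct) auto

lemma glued_time_0: "glued E B t \<Longrightarrow> time t = 0 \<Longrightarrow> \<exists>b\<in>B. t = Node (b, 0) {#}"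
  by (erule glued.cases) auto

text \<open>The leaves recover the partition, so trees over different partitions of \<open>V\<close> are different.\<close>

lemma leaf_sets_eq:
  assumes "partition_on V B" "glued E B t" "verts t = V"
  shows "leaf_sets t = B"
proof -
  have sub: "leaf_sets t \<subseteq> B" using assms(2) by (rule glued_leaf_sets_subset)
  have "partition_on V (leaf_sets t)"
    using sub glued_Union_leaf_sets[OF assms(2)] assms(1,3)
    unfolding partition_on_def by (auto dest: pairwise_subset)
  with sub assms(1) show ?thesis by (metis partition_subset_eq)
qed

text \<open>For a glued tree, the bound \<open>m\<close> is necessarily the time of the root; leaving it existential makes the
  condition easy to transport along \<open>cut\<close> and \<open>grow\<close>.\<close>

definition gluing_trees :: "'v set set \<Rightarrow> 'v set set \<Rightarrow> 'v assembly set" where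
  "gluing_trees E B = {t. glued E B t \<and> verts t = \<Union>B \<and> (\<exists>m. times t = {..m})}"

lemma gluing_trees_single:
  assumes "U \<noteq> {}"
  shows "gluing_trees E {U} = {Node (U, 0) {#}}"
proof -
  have "t = Node (U, 0) {#}" if "glued E {U} t" for t
    using that assms by (induction rule: glued.induct) auto
  moreover have "Node (U, 0) {#} \<in> gluing_trees E {U}"
    unfolding gluing_trees_def by (auto intro: glued.leaf exI[of _ 0])
  ultimately show ?thesis unfolding gluing_trees_def by blast
qed

section \<open>Cutting off the first step\<close>

primrec cut :: "'v assembly \<Rightarrow> 'v assembly" where
  "cut (Node l cs) = (if snd l \<le> 1 then Node (fst l, 0) {#}
     else Node (fst l, snd l - 1) (image_mset cut cs))"

text \<open>The inverse of \<open>cut\<close>. A leaf that is not a block of \<open>B\<close> was produced from a node at time \<open>1\<close>, whose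
  children were the blocks of \<open>B\<close> contained in it.\<close>

primrec grow :: "'v set set \<Rightarrow> 'v assembly \<Rightarrow> 'v assembly" where
  "grow B (Node l cs) =
    (if cs \<noteq> {#} then Node (fst l, Suc (snd l)) (image_mset (grow B) cs)
     else if fst l \<in> B then Node (fst l, 0) {#}
     else Node (fst l, 1) (image_mset (\<lambda>b. Node (b, 0) {#}) (mset_set {b\<in>B. b \<subseteq> fst l})))"

lemma verts_cut [simp]: "verts (cut t) = verts t"
  by (cases t) simp

lemma time_cut [simp]: "time (cut t) = time t - 1"
  by (cases t) simp

lemma verts_grow [simp]: "verts (grow B t) = verts t"
  by (cases t) simp

text \<open>The children of a node at time \<open>1\<close> are at time \<open>0\<close>, hence leaves. So a new leaf is a union of
  exactly two blocks.\<close>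

lemma cut_leaf_sets:
  assumes "glued E B t" "partition_on V B"
  shows "partition_on (verts t) (leaf_sets (cut t)) \<and>
    (\<forall>U\<in>leaf_sets (cut t). U \<in> B \<or> (\<exists>a\<in>B. \<exists>b\<in>B. a \<noteq> b \<and> linked E a b \<and> U = a \<union> b))"
  using assms(1)
proof (induction rule: glued.induct)
  case (leaf b)
  with assms(2) show ?case by (auto simp: partition_on_def)
next
  case (join c d i)
  have ne: "verts c \<noteq> {}" using join(4) by (auto simp: linked_def)
  show ?case
  proof (cases "i \<le> 1")
    case True
    with join glued_time_0[OF join(1)] glued_time_0[OF join(2)] obtain a b where
      ab: "a \<in> B" "b \<in> B" "c = Node (a, 0) {#}" "d = Node (b, 0) {#}" by auto
    from True join ab ne show ?thesis
      by (auto simp: partition_on_def)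
  next
    case False
    with join show ?thesis
      by (auto intro!: partition_on_Un)
  qed
qed

lemma glued_cut: "glued E B t \<Longrightarrow> glued E (leaf_sets (cut t)) (cut t)"
proof (induction rule: glued.induct)
  case (leaf b)
  then show ?case by (auto intro: glued.leaf)
next
  case (join c d i)
  show ?case
  proof (cases "i \<le> 1")
    case True
    then show ?thesis by (auto intro: glued.leaf)
  next
    case False
    have "glued E (leaf_sets (cut c) \<union> leaf_sets (cut d))
       (Node (verts (cut c) \<union> verts (cut d), i - 1) {#cut c, cut d#})"
      using join False by (intro glued.join) (auto intro: glued_mono)
    with False show ?thesis by simp
  qed
qed

lemma times_cut: "glued E B t \<Longrightarrow> times (cut t) = (\<lambda>i. i - 1) ` times t"
proof (induction rule: glued.induct)
  case (leaf b)
  then show ?case by simp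
next
  case (join c d i)
  show ?case
  proof (cases "i \<le> 1")
    case True
    with join glued_time_0[OF join(1)] glued_time_0[OF join(2)] show ?thesis by auto
  next
    case False
    with join show ?thesis by (simp add: image_Un)
  qed
qed

lemma grow_cut: "glued E B t \<Longrightarrow> partition_on V B \<Longrightarrow> grow B (cut t) = t"
proof (induction rule: glued.induct)
  case (leaf b)
  then show ?case by simp
next
  case (join c d i)
  show ?case
  proof (cases "i \<le> 1")
    case True
    with join glued_time_0[OF join(1)] glued_time_0[OF join(2)] obtain a b where
      ab: "a \<in> B" "b \<in> B" "c = Node (a, 0) {#}" "d = Node (b, 0) {#}" "i = 1" by auto
    moreover have "a \<noteq> b" using join ab by (auto simp: linked_def)
    ultimately show ?thesis using pair_subsets[OF join(9) ab(1,2)] by simp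
  next
    case False
    with join show ?thesis by simp
  qed
qed

lemma cut_grow: "glued E B' t \<Longrightarrow> cut (grow B t) = t"
  by (induction rule: glued.induct) auto

text \<open>Times need not grow by exactly one, since leaves that are blocks of \<open>B\<close> stay at time \<open>0\<close>; the
  inequality is enough to keep children below their parents.\<close>

lemma glued_grow:
  assumes "glued E B' t" "partition_on V B" "B' \<in> coarsenings E B"
  shows "glued E B (grow B t) \<and> time (grow B t) \<le> Suc (time t)"
  using assms(1)
proof (induction rule: glued.induct)
  case (leaf U)
  show ?case
  proof (cases "U \<in> B")
    case True
    then show ?thesis by (auto intro: glued.leaf)
  next
    case False
    with leaf assms(3) obtain a b where ab: "a \<in> B" "b \<in> B" "a \<noteq> b" "linked E a b" "U = a \<union> b"
      unfolding coarsenings_def by blast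
    have "a \<inter> b = {}" using ab assms(2) by (metis partition_onD2 disjointD)
    then have "glued E B (Node (a \<union> b, 1) {#Node (a, 0) {#}, Node (b, 0) {#}#})"
      using ab glued.join[of E B "Node (a, 0) {#}" "Node (b, 0) {#}" 1]
      by (auto intro: glued.leaf)
    with ab pair_subsets[OF assms(2) ab(1-3)] show ?thesis by simp
  qed
next
  case (join c d i)
  have "glued E B (Node (verts (grow B c) \<union> verts (grow B d), Suc i) {#grow B c, grow B d#})"
    using join by (intro glued.join) auto
  then show ?case by simp
qed

lemma time_1_grow:
  "glued E B' t \<Longrightarrow> U \<in> leaf_sets t \<Longrightarrow> U \<notin> B \<Longrightarrow> 1 \<in> times (grow B t)"
  by (induction rule: glued.induct) auto

lemma time_1_cut:
  assumes "glued E B t" "partition_on V B" "1 \<in> times t"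
  shows "\<not> leaf_sets (cut t) \<subseteq> B"
  using assms(1,3)
proof (induction rule: glued.induct)
  case (leaf b)
  then show ?case by simp
next
  case (join c d i)
  show ?case
  proof (cases "i \<le> 1")
    case True
    with join glued_time_0[OF join(1)] glued_time_0[OF join(2)] obtain a b where
      ab: "a \<in> B" "b \<in> B" "c = Node (a, 0) {#}" "d = Node (b, 0) {#}" "i = 1" by auto
    moreover have "a \<noteq> b" using join ab by (auto simp: linked_def)
    ultimately show ?thesis using pair_subsets(1)[OF assms(2) ab(1,2)] by simp
  next
    case False
    with join show ?thesis by auto
  qed
qed

text \<open>The hypothesis \<open>V \<notin> B\<close> excludes the tree that is a single leaf; every other tree has a node at
  time \<open>1\<close>, so that cutting yields a partition different from \<open>B\<close>.\<close>

lemma bij_betw_cut: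
  assumes part: "partition_on V B" and "V \<notin> B"
  shows "bij_betw cut (gluing_trees E B) (\<Union>B'\<in>coarsenings E B - {B}. gluing_trees E B')"
proof (rule bij_betwI[where g = "grow B"])
  have V: "\<Union>B = V" using part by (simp add: partition_on_def)
  show "cut \<in> gluing_trees E B \<rightarrow> (\<Union>B'\<in>coarsenings E B - {B}. gluing_trees E B')"
  proof
    fix t assume t: "t \<in> gluing_trees E B"
    then obtain m where m: "glued E B t" "verts t = V" "times t = {..m}"
      by (auto simp: gluing_trees_def V)
    have "time t \<noteq> 0" using glued_time_0[OF m(1)] m(2) assms(2) by fastforce
    with time_in_times[of t] m have "1 \<in> times t" by simp
    with time_1_cut[OF m(1) part] have "leaf_sets (cut t) \<noteq> B" by auto
    moreover have "(\<lambda>i. i - 1) ` {..m} = {..m - 1}"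
    proof (intro equalityI subsetI)
      fix k assume "k \<in> {..m - 1}"
      with \<open>1 \<in> times t\<close> m show "k \<in> (\<lambda>i. i - 1) ` {..m}" by (intro image_eqI[of _ _ "Suc k"]) auto
    qed auto
    ultimately show "cut t \<in> (\<Union>B'\<in>coarsenings E B - {B}. gluing_trees E B')"
      using glued_cut[OF m(1)] cut_leaf_sets[OF m(1) part] m
        glued_Union_leaf_sets[OF glued_cut[OF m(1)]]
      by (auto simp: gluing_trees_def V coarsenings_def times_cut intro!: bexI[of _ "leaf_sets (cut t)"])
  qed
  show "grow B \<in> (\<Union>B'\<in>coarsenings E B - {B}. gluing_trees E B') \<rightarrow> gluing_trees E B"
  proof
    fix t assume "t \<in> (\<Union>B'\<in>coarsenings E B - {B}. gluing_trees E B')"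
    then obtain B' m where B': "B' \<in> coarsenings E B" "B' \<noteq> B"
      and t: "glued E B' t" "verts t = \<Union>B'" "times t = {..m}"
      by (auto simp: gluing_trees_def)
    have part': "partition_on V B'" using B' by (simp add: coarsenings_def V)
    have g: "glued E B (grow B t)" using glued_grow[OF t(1) part B'(1)] by simp
    have "leaf_sets t = B'" using leaf_sets_eq[OF part' t(1)] t part' by (simp add: partition_on_def)
    with partition_subset_eq[OF part part'] B' time_1_grow[OF t(1)]
    have "1 \<in> times (grow B t)" by auto
    moreover have "0 \<in> times (grow B t)" using glued_times[OF g] by simp
    moreover have p: "{..m} = (\<lambda>i. i - 1) ` times (grow B t)"
      using times_cut[OF g] cut_grow[OF t(1), of B] t by simp
    \<comment> \<open>Truncated subtraction is injective from \<open>1\<close> on, so times from \<open>2\<close> on can be read off \<open>t\<close>.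
      Times \<open>0\<close> and \<open>1\<close> are identified by \<open>cut\<close> and are therefore treated apart.\<close>
    have "i \<in> times (grow B t)" if "2 \<le> i" "i \<le> Suc m" for i
    proof -
      from that have "i - 1 \<in> {..m}" by auto
      then obtain k where "k \<in> times (grow B t)" "i - 1 = k - 1" using p by auto
      moreover from this that have "k = i" by auto
      ultimately show ?thesis by simp
    qed
    moreover have "i \<le> Suc m" if "i \<in> times (grow B t)" for i
      using that p by (metis atMost_iff diff_le_mono image_eqI le_diff_conv Suc_eq_plus1)
    ultimately have "times (grow B t) = {..Suc m}"
      by (auto simp: set_eq_iff) (metis One_nat_def Suc_1 not_less_eq_eq le_Suc_eq le_zero_eq)
    with g t part' show "grow B t \<in> gluing_trees E B"
      by (auto simp: gluing_trees_def V partition_on_def)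
  qed
  show "grow B (cut t) = t" if "t \<in> gluing_trees E B" for t
    using that grow_cut[OF _ part] by (auto simp: gluing_trees_def)
  show "cut (grow B t) = t" if "t \<in> (\<Union>B'\<in>coarsenings E B - {B}. gluing_trees E B')" for t
    using that cut_grow by (fastforce simp: gluing_trees_def)
qed

lemma card_gluing_trees:
  assumes part: "partition_on V B" and "V \<notin> B"
    and fin: "finite (coarsenings E B)"
    and "\<And>B'. B' \<in> coarsenings E B \<Longrightarrow> B' \<noteq> B \<Longrightarrow> finite (gluing_trees E B')"
  shows "finite (gluing_trees E B) \<and>
    card (gluing_trees E B) = (\<Sum>B'\<in>coarsenings E B - {B}. card (gluing_trees E B'))"
proof -
  have V: "\<Union>B = V" using part by (simp add: partition_on_def)
  have leaves: "leaf_sets t = B'" if "B' \<in> coarsenings E B" "t \<in> gluing_trees E B'" for B' t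
    using that leaf_sets_eq[of V B' E t] by (auto simp: coarsenings_def gluing_trees_def V partition_on_def)
  have "card (\<Union>B'\<in>coarsenings E B - {B}. gluing_trees E B')
      = (\<Sum>B'\<in>coarsenings E B - {B}. card (gluing_trees E B'))"
  proof (rule card_UN_disjoint)
    show "\<forall>i\<in>coarsenings E B - {B}. \<forall>j\<in>coarsenings E B - {B}.
        i \<noteq> j \<longrightarrow> gluing_trees E i \<inter> gluing_trees E j = {}"
      using leaves by blast
  qed (use assms in auto)
  with bij_betw_same_card[OF bij_betw_cut[OF assms(1,2), of E]]
    bij_betw_finite[OF bij_betw_cut[OF assms(1,2), of E]] assms
  show ?thesis by auto
qed

section \<open>Merging neighbours in a list of blocks\<close>

text \<open>The lists without repetition whose entries form a partition of their union, in recursive form.\<close>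

primrec blocks :: "'a set list \<Rightarrow> bool" where
  "blocks [] \<longleftrightarrow> True"
| "blocks (b # bs) \<longleftrightarrow> b \<noteq> {} \<and> b \<inter> \<Union>(set bs) = {} \<and> blocks bs"

text \<open>The blocks form a path in the order of the list.\<close>

primrec path_like :: "'v set set \<Rightarrow> 'v set list \<Rightarrow> bool" where
  "path_like E [] \<longleftrightarrow> True"
| "path_like E (b # bs) \<longleftrightarrow> (\<forall>c\<in>set bs. linked E b c \<longleftrightarrow> c = hd bs) \<and> path_like E bs"

text \<open>The tail is a path, and the first block is linked exactly to the two ends of this path, which
  coincide when there are only two blocks.\<close>

primrec cycle_like :: "'v set set \<Rightarrow> 'v set list \<Rightarrow> bool" where
  "cycle_like E [] \<longleftrightarrow> False"
| "cycle_like E (b # bs) \<longleftrightarrow> (\<forall>c\<in>set bs. linked E b c \<longleftrightarrow> c = hd bs \<or> c = last bs) \<and> path_like E bs"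

text \<open>All ways to merge disjoint pairs of neighbours in a list, that is, to contract a matching of
  a path.\<close>

fun mergings :: "'a set list \<Rightarrow> 'a set list set" where
  "mergings [] = {[]}"
| "mergings [b] = {[b]}"
| "mergings (b # c # bs) = (#) b ` mergings (c # bs) \<union> (#) (b \<union> c) ` mergings bs"

text \<open>A matching of a cycle that contains the edge closing it is a matching of the path that remains
  after removing both ends of that edge.\<close>

definition cyclic_mergings :: "'a set list \<Rightarrow> 'a set list set" where
  "cyclic_mergings bs = mergings bs \<union> (#) (hd bs \<union> last bs) ` mergings (butlast (tl bs))"

lemma finite_mergings: "finite (mergings bs)"
  by (induction bs rule: mergings.induct) auto

lemma Union_mergings: "cs \<in> mergings bs \<Longrightarrow> \<Union>(set cs) = \<Union>(set bs)"
proof (induction bs arbitrary: cs rule: mergings.induct)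
  case (3 b c bs)
  from 3(3) consider p where "cs = b # p" "p \<in> mergings (c # bs)"
    | p where "cs = (b \<union> c) # p" "p \<in> mergings bs" by auto
  then show ?case
  proof cases
    case 1
    with 3(1)[of p] show ?thesis by simp
  next
    case 2
    with 3(2)[of p] show ?thesis by (simp add: Un_assoc)
  qed
qed auto

lemma mergings_Nil_iff: "cs \<in> mergings bs \<Longrightarrow> cs = [] \<longleftrightarrow> bs = []"
  by (induction bs arbitrary: cs rule: mergings.induct) auto

lemma length_mergings: "cs \<in> mergings bs \<Longrightarrow> length cs \<le> length bs \<and> length bs \<le> 2 * length cs"
proof (induction bs arbitrary: cs rule: mergings.induct)
  case (3 b c bs)
  from 3(3) consider p where "cs = b # p" "p \<in> mergings (c # bs)"
    | p where "cs = (b \<union> c) # p" "p \<in> mergings bs" by auto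
  then show ?case
  proof cases
    case 1
    with 3(1)[of p] show ?thesis by simp
  next
    case 2
    with 3(2)[of p] show ?thesis by simp
  qed
qed auto

lemma mergings_same_length: "cs \<in> mergings bs \<Longrightarrow> length cs = length bs \<Longrightarrow> cs = bs"
proof (induction bs arbitrary: cs rule: mergings.induct)
  case (3 b c bs)
  from 3(3) consider p where "cs = b # p" "p \<in> mergings (c # bs)"
    | p where "cs = (b \<union> c) # p" "p \<in> mergings bs" by auto
  then show ?case
  proof cases
    case 1
    with 3(1)[of p] 3(4) show ?thesis by simp
  next
    case 2
    with length_mergings[of p bs] 3(4) show ?thesis by simp
  qed
qed auto

lemma self_in_mergings: "bs \<in> mergings bs"
  by (induction bs rule: mergings.induct) auto

lemma blocks_mergings: "blocks bs \<Longrightarrow> cs \<in> mergings bs \<Longrightarrow> blocks cs"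
proof (induction bs arbitrary: cs rule: mergings.induct)
  case (3 b c bs)
  from 3(4) consider p where "cs = b # p" "p \<in> mergings (c # bs)"
    | p where "cs = (b \<union> c) # p" "p \<in> mergings bs" by auto
  then show ?case
  proof cases
    case 1
    with Union_mergings[OF 1(2)] 3(1)[of p] 3(3) show ?thesis by simp
  next
    case 2
    with Union_mergings[OF 2(2)] 3(2)[of p] 3(3) show ?thesis by auto
  qed
qed auto

lemma blocks_distinct: "blocks bs \<Longrightarrow> distinct bs"
  by (induction bs) auto

lemma blocks_partition: "blocks bs \<Longrightarrow> partition_on (\<Union>(set bs)) (set bs)"
proof (induction bs)
  case Nil
  then show ?case by (simp add: partition_on_empty)
next
  case (Cons b bs)
  then have "partition_on (b \<union> \<Union>(set bs)) ({b} \<union> set bs)"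
    by (intro partition_on_Un partition_on_space) auto
  then show ?case by simp
qed

lemma blocks_snoc: "blocks (bs @ [b]) \<longleftrightarrow> blocks bs \<and> b \<noteq> {} \<and> b \<inter> \<Union>(set bs) = {}"
  by (induction bs) auto

text \<open>Being linked to some block depends only on the union of the blocks, which merging preserves.\<close>

lemma linked_mergings:
  "cs \<in> mergings bs \<Longrightarrow> (\<exists>c\<in>set cs. linked E z c) \<longleftrightarrow> (\<exists>b\<in>set bs. linked E z b)"
  by (metis Union_mergings linked_Union_right)

text \<open>Merging can only enlarge the first block, and later blocks stay unlinked. The lemmas after this one treat in
  the same way links to the last block and to both end blocks.\<close>

lemma linked_hd_mergings:
  assumes "cs \<in> mergings bs" "blocks bs" "\<forall>b\<in>set bs. linked E z b \<longleftrightarrow> b = hd bs"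
  shows "\<forall>c\<in>set cs. linked E z c \<longleftrightarrow> c = hd cs"
proof (cases bs rule: mergings.cases)
  case (3 b b' bs')
  with assms(1) consider p where "cs = b # p" "p \<in> mergings (b' # bs')"
    | p where "cs = (b \<union> b') # p" "p \<in> mergings bs'" by auto
  moreover have z: "linked E z b" "\<not> (\<exists>c\<in>set (b' # bs'). linked E z c)"
    using assms(2,3) 3 by auto
  ultimately show ?thesis
  proof cases
    case 1
    have "\<not> (\<exists>c\<in>set p. linked E z c)" using linked_mergings[OF 1(2)] z(2) by blast
    with z 1 show ?thesis by auto
  next
    case 2
    have "\<not> (\<exists>c\<in>set bs'. linked E z c)" using z(2) by simp
    then have "\<not> (\<exists>c\<in>set p. linked E z c)" using linked_mergings[OF 2(2)] by blast
    with z 2 show ?thesis by auto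
  qed
qed (use assms in auto)

lemma linked_ends_Cons:
  assumes "linked E z u" "\<forall>c\<in>set p. linked E z c \<longleftrightarrow> c = last p"
  shows "\<forall>c\<in>set (u # p). linked E z c \<longleftrightarrow> c = hd (u # p) \<or> c = last (u # p)"
  using assms by (cases "p = []") auto

lemma linked_last_Cons:
  assumes "\<not> linked E z u" "p \<noteq> []" "\<forall>c\<in>set p. linked E z c \<longleftrightarrow> c = last p"
  shows "\<forall>c\<in>set (u # p). linked E z c \<longleftrightarrow> c = last (u # p)"
  using assms last_in_set[of p] by (metis last.simps set_ConsD)

lemma linked_last_mergings:
  assumes "cs \<in> mergings bs" "blocks bs" "\<forall>b\<in>set bs. linked E z b \<longleftrightarrow> b = last bs"
  shows "\<forall>c\<in>set cs. linked E z c \<longleftrightarrow> c = last cs"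
  using assms
proof (induction bs arbitrary: cs rule: mergings.induct)
  case (3 b b' bs)
  have b: "\<not> linked E z b" using 3(4,5) blocks_distinct[OF 3(4)]
    by (metis distinct.simps(2) last.simps last_in_set list.distinct(1) list.set_intros(1))
  from 3(3) consider p where "cs = b # p" "p \<in> mergings (b' # bs)"
    | p where "cs = (b \<union> b') # p" "p \<in> mergings bs" by auto
  then show ?case
  proof cases
    case 1
    have "\<forall>c\<in>set p. linked E z c \<longleftrightarrow> c = last p"
      by (rule 3(1)[OF 1(2)]) (use 3(4,5) in auto)
    with b mergings_Nil_iff[OF 1(2)] show ?thesis
      unfolding 1(1) by (intro linked_last_Cons) simp_all
  next
    case 2
    show ?thesis
    proof (cases "bs = []")
      case True
      with 2 3(5) show ?thesis by simp
    next
      case False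
      then have "last bs \<in> set bs" by simp
      then have "b' \<noteq> last bs" using blocks_distinct[OF 3(4)] by auto
      with 3(5) False b have "\<not> linked E z (b \<union> b')" by simp
      moreover have "\<forall>c\<in>set p. linked E z c \<longleftrightarrow> c = last p"
        by (rule 3(2)[OF 2(2)]) (use 3(4,5) False in auto)
      ultimately show ?thesis
        using False mergings_Nil_iff[OF 2(2)] unfolding 2(1) by (intro linked_last_Cons) simp_all
    qed
  qed
qed auto

lemma linked_ends_mergings:
  assumes "cs \<in> mergings bs" "blocks bs" "\<forall>b\<in>set bs. linked E z b \<longleftrightarrow> b = hd bs \<or> b = last bs"
  shows "\<forall>c\<in>set cs. linked E z c \<longleftrightarrow> c = hd cs \<or> c = last cs"
proof (cases bs rule: mergings.cases)
  case (3 b b' bs')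
  have dist: "distinct bs" using assms(2) by (rule blocks_distinct)
  from assms(1) 3 consider p where "cs = b # p" "p \<in> mergings (b' # bs')"
    | p where "cs = (b \<union> b') # p" "p \<in> mergings bs'" by auto
  then show ?thesis
  proof cases
    case 1
    have "\<forall>c\<in>set p. linked E z c \<longleftrightarrow> c = last p"
      by (rule linked_last_mergings[OF 1(2)]) (use assms 3 dist in auto)
    with assms(3) 3 show ?thesis unfolding 1(1) by (intro linked_ends_Cons) simp_all
  next
    case 2
    have "\<forall>c\<in>set p. linked E z c \<longleftrightarrow> c = last p"
    proof (cases "bs' = []")
      case False
      show ?thesis
        by (rule linked_last_mergings[OF 2(2)]) (use assms 3 dist False in auto)
    qed (use 2 in simp)
    with assms(3) 3 show ?thesis unfolding 2(1) by (intro linked_ends_Cons) simp_all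
  qed
qed (use assms in auto)

lemma path_like_mergings:
  "cs \<in> mergings bs \<Longrightarrow> blocks bs \<Longrightarrow> path_like E bs \<Longrightarrow> path_like E cs"
proof (induction bs arbitrary: cs rule: mergings.induct)
  case (3 b b' bs)
  from 3(3) consider p where "cs = b # p" "p \<in> mergings (b' # bs)"
    | p where "cs = (b \<union> b') # p" "p \<in> mergings bs" by auto
  then show ?case
  proof cases
    case 1
    have "\<forall>c\<in>set p. linked E b c \<longleftrightarrow> c = hd p"
      by (rule linked_hd_mergings[OF 1(2)]) (use 3 in auto)
    with 1 3 show ?thesis by auto
  next
    case 2
    have "\<forall>c\<in>set p. linked E b' c \<longleftrightarrow> c = hd p"
      by (rule linked_hd_mergings[OF 2(2)]) (use 3 in auto)
    moreover have "\<not> linked E b c" if "c \<in> set p" for c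
    proof -
      have "\<not> (\<exists>c\<in>set bs. linked E b c)" using 3(4,5) by auto
      with linked_mergings[OF 2(2), of E b] that show ?thesis by blast
    qed
    ultimately show ?thesis using 2 3 by auto
  qed
qed auto

lemma path_like_snoc:
  "path_like E (bs @ [z]) \<Longrightarrow> z \<notin> set bs \<Longrightarrow> path_like E bs \<and> (\<forall>b\<in>set bs. linked E z b \<longleftrightarrow> b = last bs)"
proof (induction bs)
  case (Cons b bs)
  show ?case
  proof (cases "bs = []")
    case True
    with Cons show ?thesis by (simp add: linked_commute)
  next
    case False
    then have "hd bs \<noteq> z" using Cons(3) by auto
    moreover have "linked E z b = linked E b z" by (rule linked_commute)
    ultimately have "\<not> linked E z b" using Cons(2) False by auto
    moreover have "b \<noteq> last bs" if "linked E z (last bs)" using that \<open>\<not> linked E z b\<close> by auto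
    ultimately show ?thesis using Cons False by auto
  qed
qed auto

section \<open>Coarsenings of circular partitions\<close>

lemma coarsenings_path:
  "blocks bs \<Longrightarrow> path_like E bs \<Longrightarrow> coarsenings E (set bs) = set ` mergings bs"
proof (induction bs rule: mergings.induct)
  case 1
  then show ?case by (simp add: coarsenings_empty)
next
  case (2 b)
  then show ?case
    using coarsenings_insert[of b b "{}" E] by (simp add: coarsenings_empty partition_on_space)
next
  case (3 b c bs)
  have part: "partition_on (\<Union>(set (b # c # bs))) (insert b (set (c # bs)))"
    using blocks_partition[OF 3(3)] by simp
  have dist: "distinct (b # c # bs)" using blocks_distinct 3(3) by blast
  have "{d\<in>set (c # bs). linked E b d} = {c}" using 3(4) by auto
  moreover have "set (c # bs) - {c} = set bs" using dist by auto
  ultimately have "coarsenings E (set (b # c # bs)) =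
      insert b ` coarsenings E (set (c # bs)) \<union> insert (b \<union> c) ` coarsenings E (set bs)"
    using coarsenings_insert[OF part] dist by simp
  also have "\<dots> = set ` mergings (b # c # bs)"
    using 3 by (simp add: image_Un image_image)
  finally show ?case .
qed

text \<open>For two blocks, merging the last block with the first one and merging the first with the second
  one are the same; so the equation still holds, but only \<open>length bs \<ge> 3\<close> makes the two summands
  of \<open>cyclic_mergings\<close> disjoint.\<close>

lemma coarsenings_cycle:
  assumes "blocks bs" "cycle_like E bs" "length bs \<ge> 2"
  shows "coarsenings E (set bs) = set ` cyclic_mergings bs"
proof -
  obtain b c r where bs: "bs = b # c # r" using assms(3) by (auto simp: numeral_2_eq_2 Suc_le_length_iff)
  define s z where "s = butlast (c # r)" and "z = last (c # r)"
  have sz: "c # r = s @ [z]" by (simp add: s_def z_def)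
  have part: "partition_on (\<Union>(set bs)) (insert b (set (c # r)))"
    using blocks_partition[OF assms(1)] bs by simp
  have dist: "distinct (b # c # r)" using blocks_distinct assms(1) bs by blast
  then have zs: "z \<notin> set s" using sz by (metis distinct.simps(2) distinct_append disjoint_iff list.set_intros(1))
  have "\<forall>d\<in>set (c # r). linked E b d \<longleftrightarrow> d = c \<or> d = z"
    using assms(2) unfolding bs z_def by simp
  moreover have "z \<in> set (c # r)" "c \<in> set (c # r)" unfolding z_def by (rule last_in_set) simp_all
  ultimately have lk: "{d\<in>set (c # r). linked E b d} = {c, z}" by blast
  have "set (c # r) - {c} = set r" using dist by auto
  moreover have "set (c # r) - {z} = set s" using zs unfolding sz by auto
  ultimately have co: "coarsenings E (set bs) = insert b ` coarsenings E (set (c # r)) \<union>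
       insert (b \<union> c) ` coarsenings E (set r) \<union> insert (b \<union> z) ` coarsenings E (set s)"
    using coarsenings_insert[OF part, of E] dist unfolding lk by (simp add: bs Un_assoc)
  have "blocks s" "path_like E s"
    using assms bs sz blocks_snoc[of s z] path_like_snoc[of E s z] zs by auto
  then have s: "coarsenings E (set s) = set ` mergings s" by (rule coarsenings_path)
  have cr: "coarsenings E (set (c # r)) = set ` mergings (c # r)"
    by (rule coarsenings_path) (use assms(1,2) bs in auto)
  have r: "coarsenings E (set r) = set ` mergings r"
    by (rule coarsenings_path) (use assms(1,2) bs in auto)
  have "cyclic_mergings bs =
      (#) b ` mergings (c # r) \<union> (#) (b \<union> c) ` mergings r \<union> (#) (b \<union> z) ` mergings s"
    by (simp add: cyclic_mergings_def bs s_def z_def)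
  then show ?thesis unfolding co cr r s by (simp add: image_Un image_image)
qed

text \<open>The first block of the result is the old first block, possibly united with its right or left
  neighbour. In each case it is linked exactly to both ends of a path \<open>p\<close> obtained by merging
  neighbours in what remains of the old path.\<close>

lemma cycle_like_mergings:
  assumes "blocks bs" "cycle_like E bs" "length bs \<ge> 2" "cs \<in> cyclic_mergings bs"
  shows "blocks cs \<and> cycle_like E cs"
proof -
  obtain b c r where bs: "bs = b # c # r" using assms(3) by (auto simp: numeral_2_eq_2 Suc_le_length_iff)
  define s z where "s = butlast (c # r)" and "z = last (c # r)"
  have sz: "c # r = s @ [z]" by (simp add: s_def z_def)
  have dist: "distinct (b # c # r)" using blocks_distinct assms(1) bs by blast
  have blcr: "blocks (c # r)" and pcr: "path_like E (c # r)" and b: "b \<noteq> {}" "b \<inter> \<Union>(set (c # r)) = {}"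
    and lb: "\<forall>d\<in>set (c # r). linked E b d \<longleftrightarrow> d = c \<or> d = z"
    using assms bs by (auto simp: z_def)
  from assms(4) bs consider p where "cs = b # p" "p \<in> mergings (c # r)"
    | p where "cs = (b \<union> c) # p" "p \<in> mergings r"
    | p where "cs = (b \<union> z) # p" "p \<in> mergings s"
    by (auto simp: cyclic_mergings_def s_def z_def)
  then show ?thesis
  proof cases
    case 1
    have "\<forall>d\<in>set p. linked E b d \<longleftrightarrow> d = hd p \<or> d = last p"
      by (rule linked_ends_mergings[OF 1(2) blcr]) (use lb in \<open>simp add: z_def\<close>)
    with 1 b blcr pcr show ?thesis
      using path_like_mergings[OF 1(2)] blocks_mergings[OF _ 1(2)] Union_mergings[OF 1(2)] by simp
  next
    case 2
    have "\<forall>d\<in>set p. linked E (b \<union> c) d \<longleftrightarrow> d = hd p \<or> d = last p"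
    proof (rule linked_ends_mergings[OF 2(2)])
      show "\<forall>d\<in>set r. linked E (b \<union> c) d \<longleftrightarrow> d = hd r \<or> d = last r"
      proof
        fix d assume d: "d \<in> set r"
        then have "r \<noteq> []" "d \<noteq> c" using dist by auto
        with d lb pcr show "linked E (b \<union> c) d \<longleftrightarrow> d = hd r \<or> d = last r" by (auto simp: z_def)
      qed
    qed (use blcr in simp)
    with 2 b blcr pcr show ?thesis
      using path_like_mergings[OF 2(2)] blocks_mergings[OF _ 2(2)] Union_mergings[OF 2(2)] by auto
  next
    case 3
    have bls: "blocks s" "z \<noteq> {}" "z \<inter> \<Union>(set s) = {}" using blcr unfolding sz blocks_snoc by auto
    have zs: "z \<notin> set s" using bls by auto
    have ps: "path_like E s" and zl: "\<forall>d\<in>set s. linked E z d \<longleftrightarrow> d = last s"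
      using path_like_snoc[of E s z] pcr zs unfolding sz by auto
    have "\<forall>d\<in>set p. linked E (b \<union> z) d \<longleftrightarrow> d = hd p \<or> d = last p"
    proof (rule linked_ends_mergings[OF 3(2) bls(1)])
      show "\<forall>d\<in>set s. linked E (b \<union> z) d \<longleftrightarrow> d = hd s \<or> d = last s"
      proof
        fix d assume d: "d \<in> set s"
        then have "s \<noteq> []" "d \<noteq> z" using zs by auto
        moreover from this have "hd s = c" using sz by (metis hd_append2 list.sel(1))
        moreover have "d \<in> set (c # r)" using d unfolding sz by simp
        ultimately show "linked E (b \<union> z) d \<longleftrightarrow> d = hd s \<or> d = last s" using d lb zl by auto
      qed
    qed
    moreover have "b \<inter> \<Union>(set s) = {}" using b(2) unfolding sz by auto
    ultimately show ?thesis using 3 b bls ps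
      using path_like_mergings[OF 3(2)] blocks_mergings[OF _ 3(2)] Union_mergings[OF 3(2)] by auto
  qed
qed

section \<open>Counting mergings\<close>

lemma inj_on_set_Cons:
  assumes "inj_on set A" "\<And>p. p \<in> A \<Longrightarrow> u \<notin> set p"
  shows "inj_on set ((#) u ` A)"
proof (rule inj_onI)
  fix p q assume "p \<in> (#) u ` A" "q \<in> (#) u ` A" "set p = set q"
  then obtain p' q' where pq: "p = u # p'" "q = u # q'" "p' \<in> A" "q' \<in> A" "insert u (set p') = insert u (set q')"
    by auto
  then have "set p' = set q'" using assms(2) by (metis insert_ident)
  with pq assms(1) show "p = q" by (auto dest: inj_onD)
qed

lemma inj_on_set_Un_Cons:
  assumes "inj_on set A" "inj_on set ((#) u ` A')"
    and "\<And>p. p \<in> A \<Longrightarrow> u \<notin> set p"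
  shows "inj_on set (A \<union> (#) u ` A')"
  unfolding inj_on_Un using assms by (auto dest!: arg_cong[where f = "\<lambda>X. u \<in> X"])

text \<open>The block that contains the first block of \<open>bs\<close> tells which case of the recursion applied.\<close>

lemma inj_on_set_mergings: "blocks bs \<Longrightarrow> inj_on set (mergings bs)"
proof (induction bs rule: mergings.induct)
  case (3 b c bs)
  have *: "u \<notin> set p" if "p \<in> mergings bs'" "u \<inter> \<Union>(set bs') = {}" "u \<noteq> {}" for u p and bs' :: "'a set list"
    using that Union_mergings[OF that(1)] by blast
  have **: "b \<union> c \<notin> set p" if "p \<in> mergings (c # bs)" for p
    using that Union_mergings[OF that] 3(3) by auto
  show ?case unfolding mergings.simps
  proof (rule inj_on_set_Un_Cons)
    show "inj_on set ((#) b ` mergings (c # bs))"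
      using 3 *[of _ "c # bs" b] by (intro inj_on_set_Cons) auto
    show "inj_on set ((#) (b \<union> c) ` mergings bs)"
      using 3 *[of _ bs "b \<union> c"] by (intro inj_on_set_Cons) auto
    show "b \<union> c \<notin> set p" if "p \<in> (#) b ` mergings (c # bs)" for p
    proof -
      from that obtain q where "p = b # q" "q \<in> mergings (c # bs)" by auto
      moreover have "b \<union> c \<noteq> b" using 3(3) by auto
      ultimately show ?thesis using ** by simp
    qed
  qed
qed auto

text \<open>Without the closing edge, the first block is never merged with the last one.\<close>

lemma last_notin_mergings:
  assumes "blocks bs" "length bs \<ge> 3" "cs \<in> mergings bs"
  shows "hd bs \<union> last bs \<notin> set cs"
proof -
  obtain b c r where bs: "bs = b # c # r" "r \<noteq> []" using assms(2) by (auto simp: numeral_3_eq_3 Suc_le_length_iff)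
  define z where "z = last r"
  have z: "z \<in> set r" using bs by (simp add: z_def)
  then have zb: "z \<noteq> {}" "z \<inter> (b \<union> c) = {}" "b \<noteq> {}" "b \<inter> \<Union>(set (c # r)) = {}"
    using assms(1) bs partition_onD3[OF blocks_partition[OF assms(1)]] by auto
  from assms(3) bs consider p where "cs = b # p" "p \<in> mergings (c # r)"
    | p where "cs = (b \<union> c) # p" "p \<in> mergings r" by auto
  then have "b \<union> z \<notin> set cs"
  proof cases
    case 1
    with Union_mergings[OF 1(2)] zb show ?thesis by auto
  next
    case 2
    with Union_mergings[OF 2(2)] zb show ?thesis by auto
  qed
  with bs show ?thesis by (simp add: z_def)
qed

lemma inj_on_set_cyclic_mergings:
  assumes "blocks bs" "length bs \<ge> 3"
  shows "inj_on set (cyclic_mergings bs)"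
  unfolding cyclic_mergings_def
proof (rule inj_on_set_Un_Cons)
  obtain b c r where bs: "bs = b # c # r" "r \<noteq> []" using assms(2) by (auto simp: numeral_3_eq_3 Suc_le_length_iff)
  define s z where "s = butlast (c # r)" and "z = last (c # r)"
  have sz: "c # r = s @ [z]" by (simp add: s_def z_def)
  have bl: "blocks (s @ [z])" "b \<inter> \<Union>(set (s @ [z])) = {}" "b \<noteq> {}" using assms(1) bs unfolding sz[symmetric] by auto
  have "inj_on set ((#) (b \<union> z) ` mergings s)"
  proof (rule inj_on_set_Cons)
    show "inj_on set (mergings s)" using bl by (intro inj_on_set_mergings) (simp add: blocks_snoc)
    show "b \<union> z \<notin> set p" if "p \<in> mergings s" for p
      using Union_mergings[OF that] bl by auto
  qed
  then show "inj_on set ((#) (hd bs \<union> last bs) ` mergings (butlast (tl bs)))"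
    using bs by (simp add: s_def z_def)
qed (use assms last_notin_mergings inj_on_set_mergings in auto)

text \<open>The recursion of \<open>mergings\<close> is Pascal's rule for the number of matchings of a path. The equation
  stays true for \<open>j\<close> beyond the length of the list, where truncated subtraction gives
  \<open>0 choose j = 0\<close>.\<close>

lemma card_mergings:
  "blocks bs \<Longrightarrow> card {cs \<in> mergings bs. length cs + j = length bs} = (length bs - j) choose j"
proof (induction bs arbitrary: j rule: mergings.induct)
  case 1
  then show ?case by (cases j) auto
next
  case (2 b)
  have "{cs \<in> mergings [b]. length cs + j = length [b]} = (if j = 0 then {[b]} else {})" by auto
  then show ?case by (cases j) auto
next
  case (3 b c bs)
  have ne: "b \<noteq> b \<union> c" using 3(3) by auto
  have split: "{cs \<in> mergings (b # c # bs). length cs + j = length (b # c # bs)} =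
      (#) b ` {cs \<in> mergings (c # bs). length cs + j = length (c # bs)} \<union>
      (#) (b \<union> c) ` {cs \<in> mergings bs. length cs + j = Suc (length bs)}"
    by auto
  have "card {cs \<in> mergings (b # c # bs). length cs + j = length (b # c # bs)} =
      card ((#) b ` {cs \<in> mergings (c # bs). length cs + j = length (c # bs)}) +
      card ((#) (b \<union> c) ` {cs \<in> mergings bs. length cs + j = Suc (length bs)})"
    unfolding split using ne by (intro card_Un_disjoint) (auto simp: finite_mergings)
  also have "\<dots> = card {cs \<in> mergings (c # bs). length cs + j = length (c # bs)} +
      card {cs \<in> mergings bs. length cs + j = Suc (length bs)}"
    by (simp add: card_image)
  also have "\<dots> = (Suc (length bs) - j choose j) + card {cs \<in> mergings bs. length cs + j = Suc (length bs)}"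
    using 3 by simp
  also have "\<dots> = (length (b # c # bs) - j) choose j"
  proof (cases j)
    case 0
    have "{cs \<in> mergings bs. length cs + j = Suc (length bs)} = {}"
      using length_mergings[of _ bs] 0 by fastforce
    with 0 show ?thesis by (simp del: Collect_empty_eq)
  next
    case (Suc i)
    have "card {cs \<in> mergings bs. length cs + j = Suc (length bs)} = (length bs - i) choose i"
      using 3(2)[of i] 3(3) Suc by simp
    with Suc show ?thesis by (cases "i \<le> length bs") (auto simp: Suc_diff_le)
  qed
  finally show ?case .
qed

lemma card_cyclic_mergings:
  assumes "blocks bs" "length bs \<ge> 3" "1 \<le> j" "j \<le> length bs div 2"
  shows "card {cs \<in> cyclic_mergings bs. length cs + j = length bs} =
    ((length bs - j) choose (length bs - 2 * j)) + ((length bs - j - 1) choose (length bs - 2 * j))"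
proof -
  let ?n = "length bs" and ?s = "butlast (tl bs)" and ?u = "hd bs \<union> last bs"
  have "blocks (tl bs)" "tl bs \<noteq> []" using assms(1,2) by (cases bs; auto)+
  then have "blocks ?s" using blocks_snoc[of ?s "last (tl bs)"] by simp
  have split: "{cs \<in> cyclic_mergings bs. length cs + j = ?n} =
     {cs \<in> mergings bs. length cs + j = ?n} \<union> (#) ?u ` {p \<in> mergings ?s. length p + (j - 1) = length ?s}"
    using assms by (auto simp: cyclic_mergings_def)
  have "card {cs \<in> cyclic_mergings bs. length cs + j = ?n} =
      card {cs \<in> mergings bs. length cs + j = ?n} +
      card ((#) ?u ` {p \<in> mergings ?s. length p + (j - 1) = length ?s})"
    unfolding split
  proof (intro card_Un_disjoint)
    have "?u # p \<notin> mergings bs" for p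
      using last_notin_mergings[OF assms(1,2), of "?u # p"] by auto
    then show "{cs \<in> mergings bs. length cs + j = ?n} \<inter>
        (#) ?u ` {p \<in> mergings ?s. length p + (j - 1) = length ?s} = {}" by blast
  qed (simp_all add: finite_mergings)
  also have "\<dots> = ((?n - j) choose j) + ((length ?s - (j - 1)) choose (j - 1))"
    using card_mergings[OF assms(1)] card_mergings[OF \<open>blocks ?s\<close>] by (simp add: card_image)
  also have "length ?s - (j - 1) = ?n - j - 1" using assms by simp
  also have "(?n - j) choose j = (?n - j) choose (?n - 2 * j)"
    using binomial_symmetric[of j "?n - j"] assms by (simp add: mult_2)
  also have "(?n - j - 1) choose (j - 1) = (?n - j - 1) choose (?n - 2 * j)"
    using binomial_symmetric[of "j - 1" "?n - j - 1"] assms by (simp add: mult_2)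
  finally show ?thesis .
qed

section \<open>Trees over circular partitions\<close>

text \<open>The sequence with the recurrence in question, as a target for the induction on circular
  partitions.\<close>

fun cycle_count :: "nat \<Rightarrow> nat" where
  "cycle_count n = (if n < 3 then 1 else \<Sum>j = 1..n div 2.
     (((n - j) choose (n - 2 * j)) + ((n - j - 1) choose (n - 2 * j))) * cycle_count (n - j))"

declare cycle_count.simps [simp del]

lemma cyclic_mergings_length:
  assumes "cs \<in> cyclic_mergings bs" "length bs \<ge> 2"
  shows "length cs \<le> length bs \<and> length bs \<le> 2 * length cs \<and> (length cs = length bs \<longrightarrow> cs = bs)"
  using assms length_mergings[of _ bs] length_mergings[of _ "butlast (tl bs)"] mergings_same_length[of _ bs]
  unfolding cyclic_mergings_def by fastforce

text \<open>For at least three blocks, the proper coarsenings are grouped by the number \<open>j\<close> of merged pairs,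
  which is the loss in length. One and two blocks are treated directly, because the matchings
  of a single edge are not counted by the formula for cycles.\<close>

lemma card_gluing_trees_cycle:
  assumes "blocks bs" "cycle_like E bs"
  shows "finite (gluing_trees E (set bs)) \<and> card (gluing_trees E (set bs)) = cycle_count (length bs)"
  using assms
proof (induction "length bs" arbitrary: bs rule: less_induct)
  case less
  let ?n = "length bs"
  have "?n \<noteq> 0" using less(3) by (cases bs) auto
  then consider "?n = 1" | "?n = 2" | "?n \<ge> 3" by linarith
  then show ?case
  proof cases
    case 1
    then obtain U where U: "bs = [U]" by (auto simp: length_Suc_conv)
    with less(2) have "U \<noteq> {}" by simp
    with U gluing_trees_single[of U E] show ?thesis by (simp add: cycle_count.simps)
  next
    case 2
    then obtain a b where ab: "bs = [a, b]" by (auto simp: numeral_2_eq_2 length_Suc_conv)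
    with less(2) have ne: "a \<noteq> {}" "b \<noteq> {}" "a \<inter> b = {}" by auto
    have co: "coarsenings E (set bs) = {{a, b}, {a \<union> b}}"
      using coarsenings_cycle[OF less(2,3)] 2 ab by (auto simp: cyclic_mergings_def)
    have s: "gluing_trees E {a \<union> b} = {Node (a \<union> b, 0) {#}}" using ne by (intro gluing_trees_single) auto
    have neq: "{a \<union> b} \<noteq> {a, b}" using ne by auto
    have "\<Union>(set bs) \<notin> set bs" using ab ne by auto
    from card_gluing_trees[OF blocks_partition[OF less(2)] this, of E]
    show ?thesis unfolding co using s neq ab 2
      by (auto simp: cycle_count.simps insert_Diff_if)
  next
    case 3
    note co = coarsenings_cycle[OF less(2,3)]
    have IH: "finite (gluing_trees E (set cs)) \<and> card (gluing_trees E (set cs)) = cycle_count (length cs)"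
      if "cs \<in> cyclic_mergings bs" "cs \<noteq> bs" for cs
      using that less(1)[of cs] cycle_like_mergings[OF less(2,3) _ that(1)] cyclic_mergings_length[OF that(1)] 3
      by force
    have V: "\<Union>(set bs) \<notin> set bs"
    proof -
      obtain a b r where ab: "bs = a # b # r" using 3 by (auto simp: numeral_3_eq_3 Suc_le_length_iff)
      then have "a \<in> set bs" "b \<in> set bs" "a \<noteq> b" using less(2) by auto
      with blocks_partition[OF less(2)] show ?thesis by (rule partition_Union_notin)
    qed
    have fin: "finite (cyclic_mergings bs)" by (simp add: cyclic_mergings_def finite_mergings)
    have bs: "bs \<in> cyclic_mergings bs" by (simp add: cyclic_mergings_def self_in_mergings)
    have inj: "inj_on set (cyclic_mergings bs)" using inj_on_set_cyclic_mergings[OF less(2) 3] .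
    have diff: "coarsenings E (set bs) - {set bs} = set ` (cyclic_mergings bs - {bs})"
      using co 3 inj_on_image_set_diff[OF inj, of "cyclic_mergings bs" "{bs}"] bs by auto
    have fg: "finite (gluing_trees E B')" if "B' \<in> coarsenings E (set bs)" "B' \<noteq> set bs" for B'
    proof -
      from that have "B' \<in> coarsenings E (set bs) - {set bs}" by simp
      then obtain cs where "cs \<in> cyclic_mergings bs" "cs \<noteq> bs" "B' = set cs" unfolding diff by auto
      with IH show ?thesis by simp
    qed
    have "finite (coarsenings E (set bs))" using co 3 fin by simp
    note * = card_gluing_trees[OF blocks_partition[OF less(2)] V this fg]
    have "card (gluing_trees E (set bs)) = (\<Sum>B'\<in>set ` (cyclic_mergings bs - {bs}). card (gluing_trees E B'))"
      using * diff by simp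
    also have "\<dots> = (\<Sum>cs\<in>cyclic_mergings bs - {bs}. card (gluing_trees E (set cs)))"
      using inj by (subst sum.reindex) (auto intro: inj_on_subset)
    also have "\<dots> = (\<Sum>cs\<in>cyclic_mergings bs - {bs}. cycle_count (length cs))"
      using IH by (intro sum.cong) auto
    also have "\<dots> = (\<Sum>j=1..?n div 2. \<Sum>cs\<in>{cs\<in>cyclic_mergings bs - {bs}. ?n - length cs = j}. cycle_count (length cs))"
    proof (rule sum.group[symmetric])
      show "(\<lambda>cs. ?n - length cs) ` (cyclic_mergings bs - {bs}) \<subseteq> {1..?n div 2}"
      proof (rule image_subsetI)
        fix cs assume "cs \<in> cyclic_mergings bs - {bs}"
        with cyclic_mergings_length[of cs bs] 3
        have "length cs < ?n" "?n \<le> 2 * length cs" by auto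
        then show "?n - length cs \<in> {1..?n div 2}" by auto
      qed
    qed (use fin in auto)
    also have "\<dots> = (\<Sum>j=1..?n div 2. card {cs\<in>cyclic_mergings bs. length cs + j = ?n} * cycle_count (?n - j))"
    proof (rule sum.cong[OF refl])
      fix j assume j: "j \<in> {1..?n div 2}"
      have "{cs\<in>cyclic_mergings bs - {bs}. ?n - length cs = j} = {cs\<in>cyclic_mergings bs. length cs + j = ?n}"
        using j by auto
      moreover have "(\<Sum>cs\<in>{cs\<in>cyclic_mergings bs. length cs + j = ?n}. cycle_count (length cs))
          = (\<Sum>cs\<in>{cs\<in>cyclic_mergings bs. length cs + j = ?n}. cycle_count (?n - j))"
      proof (rule sum.cong[OF refl])
        fix cs assume "cs \<in> {cs\<in>cyclic_mergings bs. length cs + j = ?n}"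
        then have "length cs + j = ?n" by simp
        then have "length cs = ?n - j" by linarith
        then show "cycle_count (length cs) = cycle_count (?n - j)" by (rule arg_cong)
      qed
      ultimately show "(\<Sum>cs\<in>{cs\<in>cyclic_mergings bs - {bs}. ?n - length cs = j}. cycle_count (length cs))
          = card {cs\<in>cyclic_mergings bs. length cs + j = ?n} * cycle_count (?n - j)"
        by simp
    qed
    also have "\<dots> = cycle_count ?n"
      using card_cyclic_mergings[OF less(2) 3] 3 by (subst cycle_count.simps) simp
    finally show ?thesis using * by simp
  qed
qed

section \<open>Assembly trees as trees over singletons\<close>

lemma nodes_self: "t \<in># nodes t"
  by (cases t) simp

lemma children_in_nodes: "x \<in># nodes t \<Longrightarrow> c \<in># children x \<Longrightarrow> c \<in># nodes t"
proof (induction t)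
  case (Node l cs)
  from Node(2) consider "x = Node l cs" | d where "d \<in># cs" "x \<in># nodes d" by auto
  then show ?case
  proof cases
    case 1
    with Node(3) have "c \<in># cs" by simp
    then show ?thesis using nodes_self[of c] by auto
  next
    case 2
    with Node(1)[OF 2(1) 2(2) Node(3)] show ?thesis by auto
  qed
qed

lemma glued_nodes: "glued E B t \<Longrightarrow> x \<in># nodes t \<Longrightarrow> glued E B x \<and> verts x \<subseteq> verts t"
proof (induction rule: glued.induct)
  case (leaf b)
  then show ?case by (auto intro: glued.leaf)
next
  case (join c d i)
  from join(9) consider "x = Node (verts c \<union> verts d, i) {#c, d#}" | "x \<in># nodes c" | "x \<in># nodes d"
    by auto
  then show ?case
  proof cases
    case 1
    with join(1-6) show ?thesis by (auto intro: glued.join)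
  qed (use join in auto)
qed

definition leaf_labels :: "'v assembly \<Rightarrow> ('v set \<times> nat) multiset" where
  "leaf_labels t = image_mset label (filter_mset is_leaf (nodes t))"

lemma leaf_labels_leaf [simp]: "leaf_labels (Node l {#}) = {#l#}"
  by (simp add: leaf_labels_def is_leaf_def)

lemma leaf_labels_join [simp]: "leaf_labels (Node l {#c, d#}) = leaf_labels c + leaf_labels d"
  by (simp add: leaf_labels_def is_leaf_def)

lemma vertex_labels: "image_mset (\<lambda>v. ({v}, 0::nat)) (mset_set V) = mset_set ((\<lambda>v. ({v}, 0)) ` V)"
  by (rule image_mset_mset_set) (auto simp: inj_on_def)

lemma glued_leaf_labels:
  "glued E ((\<lambda>v. {v}) ` V) t \<Longrightarrow> finite V \<Longrightarrow>
    leaf_labels t = mset_set ((\<lambda>v. ({v}, 0)) ` verts t) \<and> verts t \<subseteq> V \<and> verts t \<noteq> {}"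
proof (induction rule: glued.induct)
  case (leaf b)
  then show ?case by auto
next
  case (join c d i)
  then have "finite (verts c)" "finite (verts d)" by (auto intro: finite_subset)
  moreover from join have "((\<lambda>v. ({v}, 0::nat)) ` verts c) \<inter> ((\<lambda>v. ({v}, 0)) ` verts d) = {}" by auto
  ultimately show ?case using join by (simp add: image_Un mset_set_Union)
qed

text \<open>The bound on the time of the root: the two subtrees of a node share the time \<open>0\<close>, which makes room
  for the time of the node itself.\<close>

lemma glued_card_times:
  "glued E ((\<lambda>v. {v}) ` V) t \<Longrightarrow> finite V \<Longrightarrow> card (times t) \<le> card (verts t)"
proof (induction rule: glued.induct)
  case (leaf b)
  then show ?case by auto
next
  case (join c d i)
  have fin: "finite (verts c)" "finite (verts d)"
    using glued_leaf_labels[OF join(1,9)] glued_leaf_labels[OF join(2,9)] join(9)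
    by (auto intro: finite_subset)
  have t: "finite (times c)" "finite (times d)" "0 \<in> times c \<inter> times d"
    using glued_times[OF join(1)] glued_times[OF join(2)] by auto
  have "card (times c \<inter> times d) \<noteq> 0" using t by (auto simp: card_eq_0_iff)
  then have "card (times c \<union> times d) < card (times c) + card (times d)"
    using card_Un_Int[OF t(1,2)] by linarith
  moreover have "card (insert i (times c \<union> times d)) \<le> Suc (card (times c \<union> times d))"
    by (rule card_insert_le_m1) (use t in auto)
  ultimately show ?case using join card_Un_disjoint[OF fin] by simp
qed

text \<open>The leaves below a node form a sub-multiset of the vertices, each taken once. Hence no vertex can
  occur below both children, which is the disjointness that \<open>glued\<close> asks for.\<close>

lemma gluedI:
  assumes "finite V"
    and "\<And>x. x \<in># nodes s \<Longrightarrow> \<not> is_leaf x \<Longrightarrow> \<exists>c d. children x = {#c, d#} \<and>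
      linked E (verts c) (verts d) \<and> verts x = verts c \<union> verts d \<and> time c < time x \<and> time d < time x"
    and "leaf_labels s \<subseteq># mset_set ((\<lambda>v. ({v}, 0)) ` V)"
  shows "glued E ((\<lambda>v. {v}) ` V) s"
  using assms(2,3)
proof (induction s)
  case (Node l cs)
  show ?case
  proof (cases "cs = {#}")
    case True
    with Node(3) assms(1) obtain v where "v \<in> V" "l = ({v}, 0)" by auto
    with True show ?thesis by (auto intro: glued.leaf)
  next
    case False
    with Node(2)[of "Node l cs"] obtain c d where cd: "cs = {#c, d#}"
      and l: "linked E (verts c) (verts d)" "l = (verts c \<union> verts d, snd l)" "time c < snd l" "time d < snd l"
      by (cases l) (auto simp: is_leaf_def)
    have sum: "leaf_labels c + leaf_labels d \<subseteq># mset_set ((\<lambda>v. ({v}, 0)) ` V)" using Node(3) cd by simp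
    have gc: "glued E ((\<lambda>v. {v}) ` V) c"
    proof (rule Node(1))
      show "leaf_labels c \<subseteq># mset_set ((\<lambda>v. ({v}, 0)) ` V)" using sum by (rule mset_subset_eq_add_left[THEN subset_mset.order_trans])
    qed (use cd Node(2) in auto)
    have gd: "glued E ((\<lambda>v. {v}) ` V) d"
    proof (rule Node(1))
      show "leaf_labels d \<subseteq># mset_set ((\<lambda>v. ({v}, 0)) ` V)" using sum by (rule mset_subset_eq_add_right[THEN subset_mset.order_trans])
    qed (use cd Node(2) in auto)
    have "verts c \<inter> verts d = {}"
    proof (rule ccontr)
      assume "verts c \<inter> verts d \<noteq> {}"
      then obtain v where v: "v \<in> verts c" "v \<in> verts d" by auto
      have fin: "finite (verts c)" "finite (verts d)"
        using glued_leaf_labels[OF gc] glued_leaf_labels[OF gd] assms(1) by (auto intro: finite_subset)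
      have "count (leaf_labels c + leaf_labels d) ({v}, 0) = 2"
        using glued_leaf_labels[OF gc] glued_leaf_labels[OF gd] assms(1) v fin by (simp add: count_mset_set')
      moreover have "count (leaf_labels c + leaf_labels d) ({v}, 0) \<le> count (mset_set ((\<lambda>v. ({v}, 0::nat)) ` V)) ({v}, 0)"
        using sum by (rule mset_subset_eq_count)
      ultimately show False by (simp add: count_mset_set' split: if_splits)
    qed
    then have "glued E ((\<lambda>v. {v}) ` V) (Node (verts c \<union> verts d, snd l) {#c, d#})"
      using gc gd l by (intro glued.join)
    with l(2) cd show ?thesis by simp
  qed
qed

text \<open>The condition on adjacent nodes is symmetric in form, but the vertex set of a child is strictly
  contained in that of its parent, so it only constrains a child and its parent in this order.\<close>

lemma assembly_trees_eq_gluing_trees: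
  assumes "finite V" "2 \<le> card V"
  shows "{t. time_dependent_assembly_tree (V, E) t \<and> edge_gluing_rule (V, E) t} =
    gluing_trees E ((\<lambda>v. {v}) ` V)"
proof (intro equalityI subsetI)
  fix t assume "t \<in> {t. time_dependent_assembly_tree (V, E) t \<and> edge_gluing_rule (V, E) t}"
  then have leaves: "leaf_labels t = mset_set ((\<lambda>v. ({v}, 0)) ` V)"
    and root: "verts t = V"
    and union: "\<And>s. s \<in># nodes t \<Longrightarrow> \<not> is_leaf s \<Longrightarrow> verts s = (\<Union>c \<in> set_mset (children s). verts c)"
    and adj: "\<And>x y. adjacent_nodes t x y \<Longrightarrow> verts x \<subseteq> verts y \<Longrightarrow> time x < time y"
    and all: "\<And>i. i \<le> time t \<Longrightarrow> \<exists>s \<in># nodes t. time s = i"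
    and bin: "\<And>s. s \<in># nodes t \<Longrightarrow> \<not> is_leaf s \<Longrightarrow> \<exists>c d. children s = {#c, d#} \<and> linked E (verts c) (verts d)"
    using assms(2)
    by (auto simp: time_dependent_assembly_tree_def edge_gluing_rule_def leaf_labels_def vertex_labels linked_def)
  have g: "glued E ((\<lambda>v. {v}) ` V) t"
  proof (rule gluedI[OF assms(1)])
    fix x assume x: "x \<in># nodes t" "\<not> is_leaf x"
    from bin[OF x] obtain c d where cd: "children x = {#c, d#}" "linked E (verts c) (verts d)" by blast
    have v: "verts x = verts c \<union> verts d" using union[OF x] cd by simp
    have "time e < time x" if "e \<in># children x" for e
    proof (rule adj)
      show "adjacent_nodes t e x"
        using that x children_in_nodes[OF x(1) that] by (simp add: adjacent_nodes_def)
      show "verts e \<subseteq> verts x" using that union[OF x] by auto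
    qed
    with cd v show "\<exists>c d. children x = {#c, d#} \<and> linked E (verts c) (verts d) \<and>
      verts x = verts c \<union> verts d \<and> time c < time x \<and> time d < time x" by auto
  qed (simp add: leaves)
  have "times t = {..time t}"
    using glued_times_le[OF g] all by (fastforce simp: times_def)
  with g root show "t \<in> gluing_trees E ((\<lambda>v. {v}) ` V)" by (auto simp: gluing_trees_def)
next
  fix t assume "t \<in> gluing_trees E ((\<lambda>v. {v}) ` V)"
  then obtain m where g: "glued E ((\<lambda>v. {v}) ` V) t" and V: "verts t = V" and m: "times t = {..m}"
    by (auto simp: gluing_trees_def)
  have mt: "m = time t" using glued_times_le[OF g, of m] time_in_times[of t] m by auto
  have "Suc m \<le> card V" using glued_card_times[OF g assms(1)] V m by simp
  moreover have "m \<noteq> 0"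
  proof
    assume "m = 0"
    with mt glued_time_0[OF g] obtain v where "t = Node ({v}, 0) {#}" by auto
    with V assms(2) show False by auto
  qed
  ultimately have label: "1 \<le> m \<and> m \<le> card V - 1 \<and> label t = (V, m)"
    using V mt by (auto simp: prod_eq_iff)
  have node: "is_leaf x \<or> (\<exists>c d. children x = {#c, d#} \<and> linked E (verts c) (verts d) \<and>
      verts x = verts c \<union> verts d \<and> time c < time x \<and> time d < time x \<and>
      verts c \<subset> verts x \<and> verts d \<subset> verts x)" if "x \<in># nodes t" for x
  proof -
    have "glued E ((\<lambda>v. {v}) ` V) x" using glued_nodes[OF g that] by simp
    then show ?thesis
    proof cases
      case (join c d i)
      have "verts c \<noteq> {}" "verts d \<noteq> {}" using join by (auto simp: linked_def)
      with join show ?thesis by (intro disjI2 exI[of _ c] exI[of _ d]) auto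
    qed (simp add: is_leaf_def)
  qed
  have adj: "time x < time y" if "adjacent_nodes t x y" "verts x \<subseteq> verts y" for x y
  proof -
    from that(1) consider "x \<in># nodes t" "y \<in># children x" | "y \<in># nodes t" "x \<in># children y"
      by (auto simp: adjacent_nodes_def)
    then show ?thesis
    proof cases
      case 1
      with node[OF 1(1)] that(2) show ?thesis by (auto simp: is_leaf_def)
    next
      case 2
      with node[OF 2(1)] show ?thesis by (auto simp: is_leaf_def)
    qed
  qed
  have "verts s \<subseteq> V" if "s \<in># nodes t" for s using glued_nodes[OF g that] V by simp
  moreover have "image_mset label (filter_mset is_leaf (nodes t)) = image_mset (\<lambda>v. ({v}, 0)) (mset_set V)"
    using glued_leaf_labels[OF g assms(1)] V by (simp add: leaf_labels_def vertex_labels)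
  moreover have "size (children s) \<ge> 2" "verts s = (\<Union>c \<in> set_mset (children s). verts c)"
    if "s \<in># nodes t" "\<not> is_leaf s" for s
    using node[OF that(1)] that(2) by auto
  moreover have "\<exists>s \<in># nodes t. time s = i" if "i \<le> time t" for i
  proof -
    have "i \<in> times t" using that m mt by simp
    then show ?thesis by (auto simp: times_def)
  qed
  ultimately have "time_dependent_assembly_tree (V, E) t"
    using label adj assms(2) unfolding time_dependent_assembly_tree_def by simp
  moreover have "edge_gluing_rule (V, E) t"
    unfolding edge_gluing_rule_def using node by (fastforce simp: linked_def)
  ultimately show "t \<in> {t. time_dependent_assembly_tree (V, E) t \<and> edge_gluing_rule (V, E) t}" by simp
qed

section \<open>Cycle graphs\<close>

lemma blocks_singletons: "distinct xs \<Longrightarrow> blocks (map (\<lambda>v. {v}) xs)"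
  by (induction xs) auto

lemma cycle_graph_edge_iff:
  assumes "1 \<le> a" "a < c"
  shows "{a, c} \<in> snd (cycle_graph n) \<longleftrightarrow> c \<le> n \<and> (c = Suc a \<or> n \<ge> 3 \<and> a = 1 \<and> c = n)"
  using assms by (auto simp: cycle_graph_def doubleton_eq_iff)

lemma path_like_cycle_graph:
  "2 \<le> a \<Longrightarrow> path_like (snd (cycle_graph n)) (map (\<lambda>v. {v}) [a..<Suc n])"
proof (induction "Suc n - a" arbitrary: a)
  case 0
  then show ?case by simp
next
  case (Suc k)
  then have a: "[a..<Suc n] = a # [Suc a..<Suc n]" by (intro upt_conv_Cons) simp
  have "linked (snd (cycle_graph n)) {a} {c} \<longleftrightarrow> {c} = hd (map (\<lambda>v. {v}) [Suc a..<Suc n])"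
    if "c \<in> set [Suc a..<Suc n]" for c
  proof -
    from that have "hd [Suc a..<Suc n] = Suc a" by (intro hd_upt) simp
    moreover have "[Suc a..<Suc n] \<noteq> []" using that by auto
    ultimately show ?thesis
      using that Suc(3) cycle_graph_edge_iff[of a c n] by (auto simp: linked_def hd_map)
  qed
  with Suc show ?case unfolding a by auto
qed

lemma cycle_like_cycle_graph:
  assumes "2 \<le> n"
  shows "cycle_like (snd (cycle_graph n)) (map (\<lambda>v. {v}) [1..<Suc n])"
proof -
  have a: "[1..<Suc n] = 1 # [2..<Suc n]" using assms by (simp add: upt_conv_Cons numeral_2_eq_2)
  have ne: "[2..<Suc n] \<noteq> []" using assms by simp
  have hl: "hd [2..<Suc n] = 2" "last [2..<Suc n] = n"
    using assms by (simp_all add: hd_upt last_upt del: upt_Suc)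
  have "linked (snd (cycle_graph n)) {1} {c} \<longleftrightarrow> {c} = {2} \<or> {c} = {n}" if "c \<in> set [2..<Suc n]" for c
    using that cycle_graph_edge_iff[of 1 c n] assms by (auto simp: linked_def)
  moreover have "hd (map (\<lambda>v. {v}) [2..<Suc n]) = {2}" "last (map (\<lambda>v. {v}) [2..<Suc n]) = {n}"
    unfolding hd_map[OF ne] last_map[OF ne] hl by (rule refl)+
  ultimately have "\<forall>b\<in>set (map (\<lambda>v. {v}) [2..<Suc n]). linked (snd (cycle_graph n)) {1} b \<longleftrightarrow>
      b = hd (map (\<lambda>v. {v}) [2..<Suc n]) \<or> b = last (map (\<lambda>v. {v}) [2..<Suc n])"
    by (simp del: upt_Suc)
  with path_like_cycle_graph[of 2 n] show ?thesis
    unfolding a list.map cycle_like.simps by blast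
qed

lemma num_edge_glued_trees_cycle:
  assumes "1 \<le> n"
  shows "num_edge_glued_trees (cycle_graph n) = cycle_count n"
proof (cases "n = 1")
  case True
  have "{t. time_dependent_assembly_tree (cycle_graph 1) t \<and> edge_gluing_rule (cycle_graph 1) t}
      = {Node ({1}, 0) {#}}"
    by (auto simp: time_dependent_assembly_tree_def edge_gluing_rule_def cycle_graph_def is_leaf_def)
  then show ?thesis using True by (simp add: num_edge_glued_trees_def cycle_count.simps)
next
  case False
  let ?bs = "map (\<lambda>v::nat. {v}) [1..<Suc n]" and ?E = "snd (cycle_graph n)"
  have c: "cycle_graph n = ({1..n}, ?E)" by (simp add: cycle_graph_def)
  have bs: "set ?bs = (\<lambda>v. {v}) ` {1..n}" by (simp add: atLeastLessThanSuc_atLeastAtMost del: upt_Suc)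
  have "num_edge_glued_trees (cycle_graph n) = card (gluing_trees ?E (set ?bs))"
    unfolding num_edge_glued_trees_def bs
    using assembly_trees_eq_gluing_trees[of "{1..n}" ?E] False assms c by simp
  also have "\<dots> = cycle_count (length ?bs)"
    using card_gluing_trees_cycle[OF blocks_singletons cycle_like_cycle_graph] False assms by simp
  finally show ?thesis using assms by simp
qed

theorem proposition4p12:
  "num_edge_glued_trees (cycle_graph 1) = 1 \<and>
   num_edge_glued_trees (cycle_graph 2) = 1 \<and>
   (\<forall>n::nat. n \<ge> 3 \<longrightarrow>
      num_edge_glued_trees (cycle_graph n) =
        (\<Sum>j = 1..n div 2.
           (((n - j) choose (n - 2 * j)) + ((n - j - 1) choose (n - 2 * j)))
             * num_edge_glued_trees (cycle_graph (n - j))))"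
proof (intro conjI allI impI)
  show "num_edge_glued_trees (cycle_graph 1) = 1" "num_edge_glued_trees (cycle_graph 2) = 1"
    by (simp_all add: num_edge_glued_trees_cycle cycle_count.simps)
  fix n :: nat assume n: "n \<ge> 3"
  have "num_edge_glued_trees (cycle_graph (n - j)) = cycle_count (n - j)" if "j \<in> {1..n div 2}" for j
    using that n by (intro num_edge_glued_trees_cycle) auto
  with n show "num_edge_glued_trees (cycle_graph n) =
        (\<Sum>j = 1..n div 2.
           (((n - j) choose (n - 2 * j)) + ((n - j - 1) choose (n - 2 * j)))
             * num_edge_glued_trees (cycle_graph (n - j)))"
    by (simp add: num_edge_glued_trees_cycle cycle_count.simps[of n])
qed

end
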